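(* Let $\Gamma$ be a (directed or undirected) strongly regular graph with parameters $(n,k,t,\lambda,\mu)$, and let $\pi=\{C_1,\ldots,C_a\}$ be a homogeneous partition of $V(\Gamma)$ into $a$ cells of size $b$ (so $ab=n$). Suppose that the $\pi$-join $\Gamma^1_\pi$ of $\Gamma$ in power $1$ is a directed strongly regular graph with parameters $(\tilde n,\tilde k,\tilde t,\tilde\lambda,\tilde\mu)$. Then: (a) $\tilde n=(a+1)n$, $\tilde k=n+k$, $\tilde t=b+t$, $\tilde\lambda=b+\lambda$, and $\tilde\mu=b+\mu$; (b) for arbitrary $i,l\in\{1,\ldots,a\}$, the number $q_{i,l}$ of arcs of $\Gamma$ starting in $C_i$ and terminating in a vertex $v\in C_l$ does not depend on the choice of $v\in C_l$, and $$q_{i,l}=\begin{cases}\lambda+b-k & \text{if } i=l,\\ \mu & \text{if } i\neq l.\end{cases}$$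
   Context: All graphs are finite, without loops or multiple arcs; an undirected edge is regarded as a pair of opposite arcs. A directed strongly regular graph (DSRG) with parameters $(n,k,t,\lambda,\mu)$ is a digraph on $n$ vertices whose adjacency matrix $A$ (a $0/1$ matrix with zero diagonal) satisfies $AJ=JA=kJ$ and $A^2=tI+\lambda A+\mu(J-I-A)$. An undirected strongly regular graph with parameters $(n,k,\lambda,\mu)$ is regarded as a DSRG with parameters $(n,k,k,\lambda,\mu)$. A partition is homogeneous of degree $b$ if all cells have exactly $b$ vertices. The $\pi$-join of $\Gamma$ in power $j$ (for a homogeneous partition $\pi=\{C_1,\dots,C_a\}$ and positive integer $j$) is the digraph $\Gamma^j_\pi$ with vertex set $V(\Gamma)\times\{0,1,\ldots,ja\}$ and the following arcs: $(u,r)\to(v,r)$ whenever $u\to v$ is an arc of $\Gamma$; and for every vertex $(u,r)$, every $i\in\{1,\ldots,a\}$ and every $m\in\{1,\ldots,j\}$, arcs from $(u,r)$ to all vertices $(v,r')$ with $v\in C_i$ and $r'\equiv r+(i-1)j+m \pmod{ja+1}$. There are no other arcs.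
   Formalization: Γ is additionally assumed to be neither empty (no arcs) nor complete (all arcs between distinct vertices); in those cases λ respectively μ is not determined by Γ and the stated formulas fail as written. *)

theory Defs
  imports
    "Graph_Theory.Pair_Digraph"
    "HOL-Library.Disjoint_Sets"
    "HOL-Number_Theory.Cong"
begin

text \<open>
  Integer matrices with rows and columns indexed by a vertex set \<open>V\<close> are functions of two
  vertices; only their values on \<open>V \<times> V\<close> matter.
\<close>

type_synonym 'v vmat = "'v \<Rightarrow> 'v \<Rightarrow> int"

definition vmat_mult :: "'v set \<Rightarrow> 'v vmat \<Rightarrow> 'v vmat \<Rightarrow> 'v vmat" where
  "vmat_mult V M N = (\<lambda>u v. \<Sum>w\<in>V. M u w * N w v)"

definition id_vmat :: "'v vmat" where
  "id_vmat = (\<lambda>u v. if u = v then 1 else 0)"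

definition ones_vmat :: "'v vmat" where
  "ones_vmat = (\<lambda>u v. 1)"

definition adjacency :: "'v pair_pre_digraph \<Rightarrow> 'v vmat" where
  "adjacency G = (\<lambda>u v. if (u, v) \<in> parcs G then 1 else 0)"

text \<open>
  The locale \<open>pair_digraph\<close> provides finiteness and the absence of loops; multiple arcs are
  impossible because \<open>parcs G\<close> is a set of pairs. An undirected graph is the case in which
  \<open>parcs G\<close> is symmetric, so undirected strongly regular graphs are included (with \<open>t = k\<close>).
\<close>

definition dsrg :: "'v pair_pre_digraph \<Rightarrow> nat \<Rightarrow> nat \<Rightarrow> nat \<Rightarrow> nat \<Rightarrow> nat \<Rightarrow> bool" where
  "dsrg G n k t lam mu \<longleftrightarrow>
     pair_digraph G \<and> card (pverts G) = n \<and>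
     (let V = pverts G; A = adjacency G; J = ones_vmat; I = id_vmat in
       \<forall>u\<in>V. \<forall>v\<in>V.
         vmat_mult V A J u v = int k * J u v \<and>
         vmat_mult V J A u v = int k * J u v \<and>
         vmat_mult V A A u v =
           int t * I u v + int lam * A u v + int mu * (J u v - I u v - A u v))"

text \<open>
  The matrix equation leaves \<open>lam\<close> arbitrary when there are no arcs (\<open>A = 0\<close>), and \<open>mu\<close> arbitrary
  when all pairs of distinct vertices are arcs (\<open>A = J - I\<close>). Strongly regular graphs are, by the usual
  convention, neither empty nor complete, so that their parameters are determined by the graph.
\<close>

definition empty_digraph :: "'v pair_pre_digraph \<Rightarrow> bool" where
  "empty_digraph G \<longleftrightarrow> parcs G = {}"

definition full_digraph :: "'v pair_pre_digraph \<Rightarrow> bool" where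
  "full_digraph G \<longleftrightarrow> parcs G = {(u, v). u \<in> pverts G \<and> v \<in> pverts G \<and> u \<noteq> v}"

text \<open>The cells \<open>C 1, \<dots>, C a\<close>; the order of the cells matters for the \<open>\<pi>\<close>-join.\<close>

definition homogeneous_partition :: "'v set \<Rightarrow> (nat \<Rightarrow> 'v set) \<Rightarrow> nat \<Rightarrow> nat \<Rightarrow> bool" where
  "homogeneous_partition V C a b \<longleftrightarrow>
     partition_on V (C ` {1..a}) \<and> inj_on C {1..a} \<and> (\<forall>i\<in>{1..a}. card (C i) = b)"

definition pi_join ::
  "'v pair_pre_digraph \<Rightarrow> (nat \<Rightarrow> 'v set) \<Rightarrow> nat \<Rightarrow> nat \<Rightarrow> ('v \<times> nat) pair_pre_digraph" where
  "pi_join G C a j =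
     \<lparr> pverts = pverts G \<times> {0..j * a},
       parcs =
         {((u, r), (v, r)) | u v r. (u, v) \<in> parcs G \<and> r \<in> {0..j * a}} \<union>
         {((u, r), (v, r')) | u v r r' i m.
            u \<in> pverts G \<and> r \<in> {0..j * a} \<and> r' \<in> {0..j * a} \<and>
            i \<in> {1..a} \<and> m \<in> {1..j} \<and> v \<in> C i \<and>
            [r' = r + (i - 1) * j + m] (mod (j * a + 1))} \<rparr>"

definition arcs_from_to :: "'v pair_pre_digraph \<Rightarrow> 'v set \<Rightarrow> 'v \<Rightarrow> nat" where
  "arcs_from_to G S v = card {e \<in> parcs G. fst e \<in> S \<and> snd e = v}"

end

theory Submission
  imports Defs
begin

text \<open>
  It suffices to compare the entries of \<open>B\<^sup>2\<close> in rows \<open>(u, 0)\<close>, where \<open>B\<close> is the adjacency matrix of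
  the join. The arcs leaving \<open>(u, 0)\<close> lead to \<open>(w, 0)\<close> for the out-neighbours \<open>w\<close> of \<open>u\<close>, and to
  \<open>(w, c w)\<close> for every vertex \<open>w\<close>, where \<open>c w\<close> is the index of the cell of \<open>w\<close>. Hence the entry at
  \<open>(v, 0)\<close> is \<open>A\<^sup>2 u v + b\<close>, which yields the parameters, and the entry at \<open>(v, d)\<close> with \<open>d \<noteq> 0\<close> is
  the number of arcs from \<open>C d\<close> to \<open>v\<close>, plus \<open>k\<close> if \<open>v\<close> lies in \<open>C d\<close> and plus \<open>b\<close> otherwise.
\<close>

text \<open>Since \<open>x + y\<close> is at most \<open>2 * a\<close>, reducing modulo
  \<open>a + 1\<close> subtracts the modulus at most once. This turns congruences between levels
  into linear arithmetic.\<close>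

lemma cong_add_Suc_iff:
  fixes s x y a :: nat
  assumes "s \<le> a" "x \<le> a" "y \<le> a"
  shows "[s = x + y] (mod (a + 1)) \<longleftrightarrow> x + y = s \<or> x + y = s + (a + 1)"
proof (cases "x + y \<le> a")
  case True
  then show ?thesis using assms by (auto simp: cong_def)
next
  case False
  then have "(x + y) mod (a + 1) = x + y - (a + 1)"
    using assms by (subst le_mod_geq) auto
  then show ?thesis using assms False by (auto simp: cong_def)
qed

lemma
  assumes "dsrg G n k t lam mu"
  shows dsrg_pair_digraph: "pair_digraph G"
    and dsrg_card: "card (pverts G) = n"
    and dsrg_row_sum: "u \<in> pverts G \<Longrightarrow> (\<Sum>w\<in>pverts G. adjacency G u w) = int k"
    and dsrg_square: "u \<in> pverts G \<Longrightarrow> v \<in> pverts G \<Longrightarrow>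
      vmat_mult (pverts G) (adjacency G) (adjacency G) u v =
      int t * id_vmat u v + int lam * adjacency G u v
        + int mu * (1 - id_vmat u v - adjacency G u v)"
  using assms by (auto simp: dsrg_def Let_def ones_vmat_def vmat_mult_def)

section \<open>Cells of a homogeneous partition\<close>

locale homogeneously_partitioned_digraph = pair_digraph G for G :: "'v pair_pre_digraph" +
  fixes C :: "nat \<Rightarrow> 'v set" and a b :: nat
  assumes homogeneous: "homogeneous_partition (pverts G) C a b"
begin

definition cell_index :: "'v \<Rightarrow> nat" where
  "cell_index v = (THE i. i \<in> {1..a} \<and> v \<in> C i)"

lemma cell_index_unique:
  assumes "v \<in> pverts G" shows "\<exists>!i. i \<in> {1..a} \<and> v \<in> C i"
proof -
  from homogeneous have part: "partition_on (pverts G) (C ` {1..a})" and inj: "inj_on C {1..a}"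
    by (auto simp: homogeneous_partition_def)
  from assms partition_onD1[OF part] obtain i where i: "i \<in> {1..a}" "v \<in> C i" by blast
  have "j = i" if "j \<in> {1..a}" "v \<in> C j" for j
  proof -
    have "C j = C i" using disjointD[OF partition_onD2[OF part], of "C j" "C i"] i that by blast
    then show ?thesis using inj_onD[OF inj] i that by blast
  qed
  with i show ?thesis by blast
qed

lemma cell_index_eq_iff:
  assumes "v \<in> pverts G" "i \<in> {1..a}" shows "cell_index v = i \<longleftrightarrow> v \<in> C i"
  using theI'[OF cell_index_unique[OF assms(1)]] cell_index_unique[OF assms(1)] assms(2)
  unfolding cell_index_def by blast

lemma cell_index_bounds:
  assumes "v \<in> pverts G" shows "0 < cell_index v" "cell_index v \<le> a"
  using theI'[OF cell_index_unique[OF assms]] by (auto simp: cell_index_def)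

lemma cell_subset: "i \<in> {1..a} \<Longrightarrow> C i \<subseteq> pverts G"
  using homogeneous by (auto simp: homogeneous_partition_def partition_on_def)

lemma cell_nonempty: "i \<in> {1..a} \<Longrightarrow> C i \<noteq> {}"
  using homogeneous by (auto simp: homogeneous_partition_def partition_on_def)

lemma sum_cell_indicator:
  assumes "i \<in> {1..a}"
  shows "(\<Sum>w\<in>pverts G. if cell_index w = i then 1 else 0) = int b"
proof -
  have "{w \<in> pverts G. cell_index w = i} = C i"
    using cell_index_eq_iff assms cell_subset by blast
  then show ?thesis
    using homogeneous assms by (simp add: sum.If_cases Int_def homogeneous_partition_def)
qed

lemma sum_adjacency_cell:
  assumes "i \<in> {1..a}"
  shows "(\<Sum>w\<in>pverts G. if cell_index w = i then adjacency G w v else 0)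
    = int (arcs_from_to G (C i) v)"
proof -
  have "(\<Sum>w\<in>pverts G. if cell_index w = i then adjacency G w v else 0)
    = (\<Sum>w\<in>pverts G. if w \<in> C i \<and> (w, v) \<in> parcs G then 1 else 0)"
    using assms by (intro sum.cong) (auto simp: cell_index_eq_iff adjacency_def)
  also have "\<dots> = int (card {w \<in> pverts G. w \<in> C i \<and> (w, v) \<in> parcs G})"
    by (simp add: sum.If_cases Int_def)
  also have "card {w \<in> pverts G. w \<in> C i \<and> (w, v) \<in> parcs G} = arcs_from_to G (C i) v"
    unfolding arcs_from_to_def using cell_subset[OF assms]
    by (intro bij_betw_same_card[of "\<lambda>w. (w, v)"]) (auto simp: bij_betw_def inj_on_def)
  finally show ?thesis .
qed

section \<open>The adjacency matrix of the join in power 1 and its square\<close>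

definition join :: "('v \<times> nat) pair_pre_digraph" where
  "join = pi_join G C a 1"

lemma pverts_join: "pverts join = pverts G \<times> {0..a}"
  by (simp add: join_def pi_join_def)

text \<open>In power 1 the shift \<open>(i - 1) * j + m\<close> is just \<open>i\<close>, so the
  cell of the head alone fixes the shift. It lies strictly between 0 and \<open>a + 1\<close>, so
  such an arc always changes the level and the two kinds of arcs never overlap.\<close>

lemma adjacency_join:
  assumes "u \<in> pverts G" "v \<in> pverts G" "r \<le> a" "s \<le> a"
  shows "adjacency join (u, r) (v, s) =
    (if r = s then adjacency G u v
     else if r + cell_index v = s \<or> r + cell_index v = s + (a + 1) then 1 else 0)"
proof -
  have "((u, r), (v, s)) \<in> parcs join \<longleftrightarrow>
    (u, v) \<in> parcs G \<and> r = s \<or> (\<exists>i\<in>{1..a}. v \<in> C i \<and> [s = r + i] (mod (a + 1)))"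
    using assms by (auto simp: join_def pi_join_def)
  also have "(\<exists>i\<in>{1..a}. v \<in> C i \<and> [s = r + i] (mod (a + 1))) \<longleftrightarrow>
      [s = r + cell_index v] (mod (a + 1))"
  proof -
    have "cell_index v \<in> {1..a}" using cell_index_bounds[OF assms(2)] by auto
    then show ?thesis using cell_index_eq_iff[OF assms(2)] by metis
  qed
  finally show ?thesis
    using assms cell_index_bounds[OF assms(2)] cong_add_Suc_iff[of s a r "cell_index v"]
    by (auto simp: adjacency_def)
qed

text \<open>The weight \<open>F\<close> is arbitrary so that one formula gives both the row sum
  (\<open>F\<close> constantly 1) and the entries of the square (\<open>F\<close> a column).\<close>

lemma sum_join_row:
  fixes F :: "'v \<times> nat \<Rightarrow> int"
  assumes "u \<in> pverts G"
  shows "(\<Sum>p\<in>pverts G \<times> {0..a}. adjacency join (u, 0) p * F p)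
    = (\<Sum>w\<in>pverts G. adjacency G u w * F (w, 0)) + (\<Sum>w\<in>pverts G. F (w, cell_index w))"
proof -
  have "(\<Sum>x\<in>{0..a}. adjacency join (u, 0) (w, x) * F (w, x))
      = adjacency G u w * F (w, 0) + F (w, cell_index w)" if w: "w \<in> pverts G" for w
  proof -
    have "(\<Sum>x\<in>{0..a}. adjacency join (u, 0) (w, x) * F (w, x))
      = (\<Sum>x\<in>{0..a}. (if x = 0 then adjacency G u w * F (w, 0) else 0)
          + (if x = cell_index w then F (w, cell_index w) else 0))"
      using cell_index_bounds[OF w] assms w
      by (intro sum.cong) (auto simp: adjacency_join)
    then show ?thesis using cell_index_bounds[OF w] by (simp add: sum.distrib)
  qed
  moreover have "(\<Sum>p\<in>pverts G \<times> {0..a}. adjacency join (u, 0) p * F p)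
    = (\<Sum>w\<in>pverts G. \<Sum>x\<in>{0..a}. adjacency join (u, 0) (w, x) * F (w, x))"
    by (simp add: sum.cartesian_product case_prod_unfold)
  ultimately show ?thesis by (simp add: sum.distrib)
qed

lemma join_square_same_level:
  assumes "u \<in> pverts G" "v \<in> pverts G"
  defines "A \<equiv> adjacency G" and "B \<equiv> adjacency join"
  shows "vmat_mult (pverts G \<times> {0..a}) B B (u, 0) (v, 0) = vmat_mult (pverts G) A A u v + int b"
proof -
  \<comment> \<open>A path that leaves level 0 returns to it in its second step exactly when the two
    shifts add up to \<open>a + 1\<close>; this selects one cell of middle vertices.\<close>
  have "(\<Sum>w\<in>pverts G. B (w, cell_index w) (v, 0))
      = (\<Sum>w\<in>pverts G. if cell_index w = a + 1 - cell_index v then 1 else 0)"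
  proof (intro sum.cong refl)
    fix w assume "w \<in> pverts G"
    then show "B (w, cell_index w) (v, 0)
        = (if cell_index w = a + 1 - cell_index v then 1 else 0)"
      using cell_index_bounds[of w] cell_index_bounds[of v] assms
      by (auto simp: adjacency_join)
  qed
  also have "\<dots> = int b"
    using cell_index_bounds[OF assms(2)] by (intro sum_cell_indicator) auto
  finally show ?thesis
    using assms by (simp add: vmat_mult_def sum_join_row adjacency_join)
qed

lemma join_square_other_level:
  assumes "u \<in> pverts G" "v \<in> pverts G" "d \<in> {1..a}"
  defines "A \<equiv> adjacency G" and "B \<equiv> adjacency join"
  shows "vmat_mult (pverts G \<times> {0..a}) B B (u, 0) (v, d) = int (arcs_from_to G (C d) v)
    + (if v \<in> C d then \<Sum>w\<in>pverts G. A u w else int b)"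
proof -
  \<comment> \<open>The representative of \<open>d - cell_index v\<close> modulo
    \<open>a + 1\<close>. It differs from \<open>d\<close>, as \<open>cell_index v\<close> is not 0
    modulo \<open>a + 1\<close>. If \<open>cell_index v = d\<close>, it is \<open>a + 1\<close>, the
    index of no cell.\<close>
  define e where
    "e = (if cell_index v < d then d - cell_index v else d + (a + 1) - cell_index v)"
  have e: "e \<in> {1..a}" if "cell_index v \<noteq> d"
    using that cell_index_bounds[OF assms(2)] assms(3) by (auto simp: e_def)
  have "(\<Sum>w\<in>pverts G. B (w, cell_index w) (v, d))
      = (\<Sum>w\<in>pverts G. (if cell_index w = d then A w v else 0)
          + (if cell_index v \<noteq> d \<and> cell_index w = e then 1 else 0))"
  proof (intro sum.cong refl)
    fix w assume "w \<in> pverts G"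
    then show "B (w, cell_index w) (v, d) = (if cell_index w = d then A w v else 0)
          + (if cell_index v \<noteq> d \<and> cell_index w = e then 1 else 0)"
      using cell_index_bounds[of w] cell_index_bounds[of v] assms
      by (auto simp: adjacency_join e_def)
  qed
  also have "\<dots> = int (arcs_from_to G (C d) v) + (if v \<in> C d then 0 else int b)"
    using sum_adjacency_cell[OF assms(3), of v, folded A_def] sum_cell_indicator[OF e]
      cell_index_eq_iff[OF assms(2,3)]
    by (simp add: sum.distrib flip: A_def)
  finally have 1: "(\<Sum>w\<in>pverts G. B (w, cell_index w) (v, d)) = \<dots>" .
  \<comment> \<open>Whether \<open>(w, 0)\<close> has an arc to \<open>(v, d)\<close> depends only
    on the cell of \<open>v\<close>, not on \<open>w\<close>.\<close>
  have "(\<Sum>w\<in>pverts G. A u w * B (w, 0) (v, d)) = (if v \<in> C d then \<Sum>w\<in>pverts G. A u w else 0)"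
    using assms cell_index_eq_iff[OF assms(2,3)] cell_index_bounds[OF assms(2)]
    by (auto simp: adjacency_join intro!: sum.cong sum.neutral)
  with 1 show ?thesis
    using assms by (simp add: vmat_mult_def sum_join_row)
qed

end

theorem theorem1:
  fixes G :: "'v pair_pre_digraph" and C :: "nat \<Rightarrow> 'v set"
    and n k t lam mu a b n' k' t' lam' mu' :: nat
  assumes "dsrg G n k t lam mu"
    and "\<not> empty_digraph G" and "\<not> full_digraph G"
    and "homogeneous_partition (pverts G) C a b"
    and "dsrg (pi_join G C a 1) n' k' t' lam' mu'"
  shows "(n' = (a + 1) * n \<and> k' = n + k \<and> t' = b + t \<and> lam' = b + lam \<and> mu' = b + mu) \<and>
    (\<forall>i\<in>{1..a}. \<forall>l\<in>{1..a}. \<exists>q :: nat.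
        (\<forall>v\<in>C l. arcs_from_to G (C i) v = q) \<and>
        int q = (if i = l then int lam + int b - int k else int mu))"
proof -
  let ?V = "pverts G" and ?A = "adjacency G"
  interpret pair_digraph G using assms(1) by (rule dsrg_pair_digraph)
  interpret homogeneously_partitioned_digraph G C a b
    using assms(4) by unfold_locales
  have join: "dsrg join n' k' t' lam' mu'" using assms(5) by (simp only: join_def)
  note n = dsrg_card[OF assms(1)] and row = dsrg_row_sum[OF assms(1)]
    and sq = dsrg_square[OF assms(1)]
  note n' = dsrg_card[OF join, unfolded pverts_join]
    and row' = dsrg_row_sum[OF join, unfolded pverts_join]
    and sq' = dsrg_square[OF join, unfolded pverts_join]
  \<comment> \<open>On level 0 the join has the same identity and adjacency entries as
    \<open>G\<close>. An arc, a diagonal pair and a pair of distinct vertices without an arc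
    therefore isolate \<open>lam\<close>, \<open>t\<close> and \<open>mu\<close> in turn.\<close>
  have same: "int t * id_vmat u v + int lam * ?A u v + int mu * (1 - id_vmat u v - ?A u v) + int b
      = int t' * id_vmat u v + int lam' * ?A u v + int mu' * (1 - id_vmat u v - ?A u v)"
    if "u \<in> ?V" "v \<in> ?V" for u v
    using join_square_same_level[OF that] sq[OF that] sq'[of "(u, 0)" "(v, 0)"] that
    by (simp add: adjacency_join id_vmat_def)
  have loopfree: "u \<noteq> v" if "(u, v) \<in> parcs G" for u v
    using no_loops[OF that] by simp
  from assms(2) obtain u0 v0 where arc: "(u0, v0) \<in> parcs G"
    by (auto simp: empty_digraph_def)
  then have u0: "u0 \<in> ?V" and v0: "v0 \<in> ?V" and "u0 \<noteq> v0"
    by (auto dest: loopfree in_arcsD1 in_arcsD2)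
  then have lam: "lam' = b + lam"
    using same[OF u0 v0] arc by (simp add: adjacency_def id_vmat_def)
  have "\<not> ?A u0 u0 = 1" by (auto simp: adjacency_def dest: loopfree)
  then have t: "t' = b + t"
    using same[OF u0 u0] by (simp add: adjacency_def id_vmat_def split: if_splits)
  have "parcs G \<subseteq> {(u, v). u \<in> ?V \<and> v \<in> ?V \<and> u \<noteq> v}"
    by (auto dest: loopfree in_arcsD1 in_arcsD2)
  with assms(3) obtain u1 v1
    where u1: "u1 \<in> ?V" and v1: "v1 \<in> ?V" and "u1 \<noteq> v1" "(u1, v1) \<notin> parcs G"
    by (auto simp: full_digraph_def)
  then have mu: "mu' = b + mu"
    using same[OF u1 v1] by (simp add: adjacency_def id_vmat_def)
  have k: "k' = n + k"
    using sum_join_row[OF u0, of "\<lambda>_. 1"] row[OF u0] row'[of "(u0, 0)"] u0 n by simp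
  \<comment> \<open>\<open>(u0, 0)\<close> has an arc to \<open>(v, i)\<close> iff
    \<open>i = l\<close>. So the entry of the square is \<open>b + lam\<close>, which equals the arc
    count plus \<open>k\<close>, if \<open>i = l\<close>, and \<open>b + mu\<close>, the count plus
    \<open>b\<close>, otherwise.\<close>
  have q: "int (arcs_from_to G (C i) v) = (if i = l then int lam + int b - int k else int mu)"
    if "i \<in> {1..a}" "l \<in> {1..a}" "v \<in> C l" for i l v
  proof -
    have v: "v \<in> ?V" using that cell_subset by blast
    have "v \<in> C i \<longleftrightarrow> i = l"
      using cell_index_eq_iff[OF v] that by metis
    then show ?thesis
      using join_square_other_level[OF u0 v that(1)] sq'[of "(u0, 0)" "(v, i)"]
        u0 v that row[OF u0] lam mu cell_index_eq_iff[OF v that(1)] cell_index_bounds[OF v]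
      by (auto simp: adjacency_join id_vmat_def)
  qed
  have "\<exists>q :: nat. (\<forall>v\<in>C l. arcs_from_to G (C i) v = q) \<and>
      int q = (if i = l then int lam + int b - int k else int mu)"
    if il: "i \<in> {1..a}" "l \<in> {1..a}" for i l
  proof -
    \<comment> \<open>An actual vertex is needed: its arc count shows that the integer on the right
      is a natural number.\<close>
    obtain v where "v \<in> C l" using cell_nonempty[OF il(2)] by blast
    then show ?thesis
      using q[OF il] by (intro exI[of _ "arcs_from_to G (C i) v"]) (metis of_nat_eq_iff)
  qed
  moreover have "n' = (a + 1) * n" using n n' by (simp add: mult.commute)
  ultimately show ?thesis using k t lam mu by blast
qed

end
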